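(* Let $(\eta,h,v)$ be a global (in time) solution to the system $$h(\theta,t)\,\partial_\theta\eta(\theta,t)=\rho_0(\theta),\qquad \partial_t v(\theta,t)+\frac1m v(\theta,t)=\frac Km\int_{\mathbb T}\sin\big(\eta(\theta_*,t)-\eta(\theta,t)\big)\rho_0(\theta_* )\,d\theta_*,\qquad \theta\in\mathbb T,\ t>0,$$ where $\partial_t\eta=v$, $\eta(\theta,0)=\theta$. Then $$\lim_{t\to\infty}\mathcal E_k(t)=0\qquad\text{and}\qquad \lim_{t\to\infty}r(t)=\sqrt{r_0^2-\frac{2m}{K}\mathcal E_k(0)+\frac4K\int_0^\infty\mathcal E_k(s)\,ds}.$$
   Context: $\mathbb T=\mathbb R/(2\pi\mathbb Z)$; $m>0$, $K>0$ are constants; $\rho_0\ge0$ with $\int_{\mathbb T}\rho_0(\theta)\,d\theta=1$. "Solution" means classical solution, with initial data $\eta(\theta,0)=\theta$, $h(\theta,0)=\rho_0(\theta)$, $v(\theta,0)=u_0(\theta)$. The mean velocity is $v_c(t)=\int_{\mathbb T}v(\theta,t)\rho_0(\theta)\,d\theta$ and the kinetic energy is $$\mathcal E_k(t)=\frac12\int_{\mathbb T}(v(\theta,t)-v_c(t))^2\rho_0(\theta)\,d\theta.$$ The order parameter $r(t)\ge0$ and average phase $\varphi(t)$ are defined by $$r(t)e^{\mathrm i\varphi(t)}=\int_{\mathbb T}e^{\mathrm i\eta(\theta,t)}\rho_0(\theta)\,d\theta,$$ and $r_0=r(0)$. *)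

theory Defs
  imports "HOL-Analysis.Analysis"
begin

text \<open>
  Functions on the circle \<open>\<real> / 2\<pi>\<int>\<close> are represented by \<open>2\<pi>\<close>-periodic functions on the reals, and the
  integral over the circle by the integral over \<open>{0..2 * pi}\<close>.  The circle-valued flow map \<open>\<eta>\<close> is
  represented by its lift to the reals starting from the identity; since \<open>\<eta>(\<cdot>, 0)\<close> is the identity,
  this lift has degree one, that is, \<open>\<eta>(\<theta> + 2\<pi>, t) = \<eta>(\<theta>, t) + 2\<pi>\<close>.  The label \<open>\<theta>\<close> is the first
  argument and the time \<open>t\<close> the second.  Values at negative times are irrelevant.
\<close>

text \<open>
  Classical means that \<open>\<eta>\<close>, \<open>h\<close>, \<open>v\<close> are continuous up to \<open>t = 0\<close> and that all derivatives occurring in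
  the system exist and are continuous for \<open>t > 0\<close>.  Continuity is only listed for \<open>\<partial>\<eta>/\<partial>\<theta>\<close>: for
  \<open>\<partial>\<eta>/\<partial>t\<close> and \<open>\<partial>v/\<partial>t\<close> it follows from the equations.
\<close>

definition global_classical_solution ::
  "real \<Rightarrow> real \<Rightarrow> (real \<Rightarrow> real) \<Rightarrow> (real \<Rightarrow> real) \<Rightarrow>
   (real \<Rightarrow> real \<Rightarrow> real) \<Rightarrow> (real \<Rightarrow> real \<Rightarrow> real) \<Rightarrow> (real \<Rightarrow> real \<Rightarrow> real) \<Rightarrow> bool" where
  "global_classical_solution m K \<rho>0 u0 \<eta> h v \<longleftrightarrow>
     (\<forall>\<theta>. \<forall>t\<ge>0. \<eta> (\<theta> + 2 * pi) t = \<eta> \<theta> t + 2 * pi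
             \<and> h (\<theta> + 2 * pi) t = h \<theta> t \<and> v (\<theta> + 2 * pi) t = v \<theta> t) \<and>
     continuous_on (UNIV \<times> {0..}) (\<lambda>(\<theta>, t). \<eta> \<theta> t) \<and>
     continuous_on (UNIV \<times> {0..}) (\<lambda>(\<theta>, t). h \<theta> t) \<and>
     continuous_on (UNIV \<times> {0..}) (\<lambda>(\<theta>, t). v \<theta> t) \<and>
     (\<forall>\<theta>. \<eta> \<theta> 0 = \<theta> \<and> h \<theta> 0 = \<rho>0 \<theta> \<and> v \<theta> 0 = u0 \<theta>) \<and>
     (\<forall>\<theta>. \<forall>t>0. (\<lambda>x. \<eta> x t) differentiable at \<theta>) \<and>
     continuous_on (UNIV \<times> {0<..}) (\<lambda>(\<theta>, t). deriv (\<lambda>x. \<eta> x t) \<theta>) \<and>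
     (\<forall>\<theta>. \<forall>t>0. (\<lambda>s. v \<theta> s) differentiable at t) \<and>
     (\<forall>\<theta>. \<forall>t>0. h \<theta> t * deriv (\<lambda>x. \<eta> x t) \<theta> = \<rho>0 \<theta>) \<and>
     (\<forall>\<theta>. \<forall>t>0. ((\<lambda>s. \<eta> \<theta> s) has_real_derivative v \<theta> t) (at t)) \<and>
     (\<forall>\<theta>. \<forall>t>0. deriv (\<lambda>s. v \<theta> s) t + 1 / m * v \<theta> t
        = K / m * integral {0..2 * pi} (\<lambda>\<theta>'. sin (\<eta> \<theta>' t - \<eta> \<theta> t) * \<rho>0 \<theta>'))"

definition mean_velocity :: "(real \<Rightarrow> real) \<Rightarrow> (real \<Rightarrow> real \<Rightarrow> real) \<Rightarrow> real \<Rightarrow> real" where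
  "mean_velocity \<rho>0 v t = integral {0..2 * pi} (\<lambda>\<theta>. v \<theta> t * \<rho>0 \<theta>)"

definition kinetic_energy :: "(real \<Rightarrow> real) \<Rightarrow> (real \<Rightarrow> real \<Rightarrow> real) \<Rightarrow> real \<Rightarrow> real" where
  "kinetic_energy \<rho>0 v t =
     1 / 2 * integral {0..2 * pi} (\<lambda>\<theta>. (v \<theta> t - mean_velocity \<rho>0 v t)\<^sup>2 * \<rho>0 \<theta>)"

text \<open>The average phase is not unique, hence a predicate on the pair \<open>(r, \<phi>)\<close>.\<close>

definition order_parameter_phase ::
  "(real \<Rightarrow> real) \<Rightarrow> (real \<Rightarrow> real \<Rightarrow> real) \<Rightarrow> (real \<Rightarrow> real) \<Rightarrow> (real \<Rightarrow> real) \<Rightarrow> bool" where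
  "order_parameter_phase \<rho>0 \<eta> r \<phi> \<longleftrightarrow>
     (\<forall>t\<ge>0. r t \<ge> 0 \<and>
        complex_of_real (r t) * exp (\<i> * complex_of_real (\<phi> t))
          = integral {0..2 * pi} (\<lambda>\<theta>. exp (\<i> * complex_of_real (\<eta> \<theta> t)) * complex_of_real (\<rho>0 \<theta>)))"

end

theory Submission
  imports Defs
begin

text \<open>
  Let \<open>C + \<i>S\<close> be the complex order parameter and \<open>D = S cos \<eta> - C sin \<eta>\<close> the coupling force.  Its
  mean vanishes, so the centred velocity \<open>w\<close> obeys \<open>m w' = -w + K D\<close>.  Since \<open>(r\<^sup>2)' = 2 \<integral> w D \<rho>0\<close>,
  the function \<open>K r\<^sup>2 / 4 - m E / 2\<close> is a primitive of the kinetic energy \<open>E\<close>.  It is bounded above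
  because \<open>r \<le> 1\<close>, so \<open>E\<close> is integrable and bounded; then \<open>E'\<close> is bounded as well, and Barbalat's
  lemma gives \<open>E \<longlongrightarrow> 0\<close>.
\<close>

section \<open>Two facts on limits at infinity: monotone convergence and Barbalat's lemma\<close>

lemma tendsto_at_top_mono_bounded:
  fixes F :: "real \<Rightarrow> real"
  assumes mono: "\<And>s t. a \<le> s \<Longrightarrow> s \<le> t \<Longrightarrow> F s \<le> F t"
    and bound: "\<And>t. a \<le> t \<Longrightarrow> F t \<le> B"
  obtains l where "(F \<longlongrightarrow> l) at_top"
proof -
  define l where "l = (SUP t\<in>{a..}. F t)"
  have bdd: "bdd_above (F ` {a..})"
    using bound by (auto intro!: bdd_aboveI)
  have "(F \<longlongrightarrow> l) at_top"
  proof (rule order_tendstoI)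
    fix y assume "y < l"
    then obtain s where s: "a \<le> s" "y < F s"
      unfolding l_def using less_cSUP_iff[OF _ bdd] by auto
    show "eventually (\<lambda>t. y < F t) at_top"
      using eventually_ge_at_top[of s] by eventually_elim (use s mono in force)
  next
    fix y assume "l < y"
    show "eventually (\<lambda>t. F t < y) at_top"
      using eventually_ge_at_top[of a]
    proof eventually_elim
      case (elim t)
      then have "F t \<le> l"
        unfolding l_def by (intro cSUP_upper bdd) auto
      with \<open>l < y\<close> show ?case by simp
    qed
  qed
  then show thesis by (rule that)
qed

text \<open>The mean of \<open>f\<close> over \<open>[t, t + d]\<close> is
  \<open>(F (t + d) - F t) / d\<close>, which tends to 0 because \<open>F\<close> converges, and it
  is attained at some \<open>s\<close>. The bound on \<open>f'\<close> keeps \<open>f t\<close>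
  close to \<open>f s\<close>.\<close>

lemma barbalat:
  fixes f F :: "real \<Rightarrow> real"
  assumes F: "\<And>t. a < t \<Longrightarrow> (F has_real_derivative f t) (at t)"
    and f: "\<And>t. a < t \<Longrightarrow> (f has_real_derivative f' t) (at t)"
    and bound: "\<And>t. a < t \<Longrightarrow> \<bar>f' t\<bar> \<le> L"
    and lim: "(F \<longlongrightarrow> l) at_top"
  shows "(f \<longlongrightarrow> 0) at_top"
proof (rule tendstoI)
  fix e :: real assume "e > 0"
  have L0: "L \<ge> 0" using bound[of "a + 1"] by linarith
  \<comment> \<open>Over a length \<open>d\<close> the function \<open>f\<close> moves by less than
    \<open>3 * e / 4\<close>; \<open>L + 1\<close> keeps the denominator positive when
    \<open>L = 0\<close>.\<close>
  define d where "d = e / (2 * (L + 1))"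
  have d: "d > 0" "L * d < e / 2 + e / 4"
    using \<open>e > 0\<close> L0 by (auto simp: d_def field_simps add_pos_nonneg)
  have "filterlim (\<lambda>t. t + d) at_top at_top"
    by (subst add.commute) (intro filterlim_tendsto_add_at_top[OF tendsto_const] filterlim_ident)
  then have "((\<lambda>t. F (t + d) - F t) \<longlongrightarrow> l - l) at_top"
    by (intro tendsto_diff lim filterlim_compose[OF lim])
  \<comment> \<open>Divided by \<open>d\<close>, this tolerance leaves \<open>e / 4\<close> for
    \<open>f s\<close>.\<close>
  then have "eventually (\<lambda>t. \<bar>F (t + d) - F t\<bar> < d * (e / 4)) at_top"
    using \<open>e > 0\<close> d by (auto dest!: tendstoD[of _ _ _ "d * (e / 4)"] simp: dist_real_def)
  then show "eventually (\<lambda>t. dist (f t) 0 < e) at_top"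
    using eventually_gt_at_top[of a]
  proof eventually_elim
    case (elim t)
    obtain s where s: "t < s" "s < t + d" "F (t + d) - F t = d * f s"
      using MVT2[of t "t + d" F f] F elim d by force
    obtain z where z: "t < z" "z < s" "f s - f t = (s - t) * f' z"
      using MVT2[of t s f f'] f elim s by force
    have "\<bar>f s - f t\<bar> \<le> d * L"
      unfolding z abs_mult using z s elim bound[of z] d by (intro mult_mono) auto
    moreover have "\<bar>f s\<bar> < e / 4"
      using elim(1) d unfolding s abs_mult by simp
    ultimately show ?case using d by (simp add: dist_real_def mult.commute)
  qed
qed

section \<open>The setting: flow map and velocity, with the velocity equation solved for its time
  derivative\<close>

locale inertial_kuramoto =
  fixes m K :: real and \<rho> :: "real \<Rightarrow> real" and \<eta> v :: "real \<Rightarrow> real \<Rightarrow> real"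
  assumes m_pos: "m > 0" and K_pos: "K > 0"
    and cont_rho: "continuous_on {0..2 * pi} \<rho>"
    and rho_nonneg: "\<And>\<theta>. \<rho> \<theta> \<ge> 0"
    and rho_integral: "(\<rho> has_integral 1) {0..2 * pi}"
    and cont_eta: "continuous_on (UNIV \<times> {0..}) (\<lambda>(\<theta>, t). \<eta> \<theta> t)"
    and cont_v: "continuous_on (UNIV \<times> {0..}) (\<lambda>(\<theta>, t). v \<theta> t)"
    and eta_deriv: "\<And>\<theta> t. t > 0 \<Longrightarrow> ((\<lambda>s. \<eta> \<theta> s) has_real_derivative v \<theta> t) (at t)"
    and v_deriv: "\<And>\<theta> t. t > 0 \<Longrightarrow> ((\<lambda>s. v \<theta> s) has_real_derivative
          K / m * integral {0..2 * pi} (\<lambda>\<theta>'. sin (\<eta> \<theta>' t - \<eta> \<theta> t) * \<rho> \<theta>') - 1 / m * v \<theta> t) (at t)"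
begin

text \<open>The composed form lets \<open>continuous_intros\<close> treat slices at a fixed time and
  functions of both variables alike.\<close>

lemma cont_eta_comp [continuous_intros]:
  assumes "continuous_on X a" "continuous_on X b" "\<And>x. x \<in> X \<Longrightarrow> b x \<ge> 0"
  shows "continuous_on X (\<lambda>x. \<eta> (a x) (b x))"
  using continuous_on_compose2[OF cont_eta continuous_on_Pair[OF assms(1,2)]] assms(3) by auto

lemma cont_v_comp [continuous_intros]:
  assumes "continuous_on X a" "continuous_on X b" "\<And>x. x \<in> X \<Longrightarrow> b x \<ge> 0"
  shows "continuous_on X (\<lambda>x. v (a x) (b x))"
  using continuous_on_compose2[OF cont_v continuous_on_Pair[OF assms(1,2)]] assms(3) by auto

lemma cont_rho_comp [continuous_intros]:
  assumes "continuous_on X a" "\<And>x. x \<in> X \<Longrightarrow> a x \<in> {0..2 * pi}"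
  shows "continuous_on X (\<lambda>x. \<rho> (a x))"
  using continuous_on_compose2[OF cont_rho assms(1)] assms(2) by blast

section \<open>Averages against the weight, and differentiation under the integral sign\<close>

definition avg :: "(real \<Rightarrow> real) \<Rightarrow> real" where
  "avg f = integral {0..2 * pi} (\<lambda>\<theta>. f \<theta> * \<rho> \<theta>)"

lemma integrable_weighted:
  assumes "continuous_on {0..2 * pi} f"
  shows "(\<lambda>\<theta>. f \<theta> * \<rho> \<theta>) integrable_on {0..2 * pi}"
  by (intro integrable_continuous_real continuous_intros assms cont_rho)

lemma avg_add:
  assumes "continuous_on {0..2 * pi} f" "continuous_on {0..2 * pi} g"
  shows "avg (\<lambda>\<theta>. f \<theta> + g \<theta>) = avg f + avg g"
  unfolding avg_def distrib_right by (intro integral_add integrable_weighted assms)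

lemma avg_diff:
  assumes "continuous_on {0..2 * pi} f" "continuous_on {0..2 * pi} g"
  shows "avg (\<lambda>\<theta>. f \<theta> - g \<theta>) = avg f - avg g"
  unfolding avg_def left_diff_distrib by (intro integral_diff integrable_weighted assms)

text \<open>Valid for every \<open>f\<close>: when \<open>f \<theta> * \<rho> \<theta>\<close> is
  not integrable, both sides are 0 by the default value of \<open>integral\<close>.\<close>

lemma avg_cmult: "avg (\<lambda>\<theta>. c * f \<theta>) = c * avg f"
  unfolding avg_def mult.assoc by (rule integral_mult_right)

text \<open>The weight has total mass 1.\<close>

lemma avg_const: "avg (\<lambda>\<theta>. c) = c"
  using has_integral_mult_right[OF rho_integral, of c]
  unfolding avg_def by (simp only: integral_unique mult_1_right)

lemma avg_mono:
  assumes "continuous_on {0..2 * pi} f" "continuous_on {0..2 * pi} g"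
    and "\<And>\<theta>. f \<theta> \<le> g \<theta>"
  shows "avg f \<le> avg g"
  unfolding avg_def
  by (intro integral_le integrable_weighted assms mult_right_mono rho_nonneg)

lemma cont_avg:
  assumes "continuous_on (T \<times> {0..2 * pi}) (\<lambda>(t, \<theta>). f t \<theta>)"
  shows "continuous_on T (\<lambda>t. avg (f t))"
  using assms unfolding avg_def box_real(2)[symmetric]
  by (intro integral_continuous_on_param)
     (auto simp: case_prod_beta intro!: continuous_intros)

text \<open>The Leibniz rule on the convex set \<open>{0<..}\<close>; since this set is open, the
  derivative within it is the derivative at \<open>t\<close>.\<close>

lemma avg_has_derivative:
  assumes der: "\<And>t \<theta>. t > 0 \<Longrightarrow> ((\<lambda>s. f s \<theta>) has_real_derivative g t \<theta>) (at t)"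
    and cont_f: "\<And>t. t > 0 \<Longrightarrow> continuous_on {0..2 * pi} (f t)"
    and cont_g: "continuous_on ({0<..} \<times> {0..2 * pi}) (\<lambda>(t, \<theta>). g t \<theta>)"
    and t: "t > 0"
  shows "((\<lambda>s. avg (f s)) has_real_derivative avg (g t)) (at t)"
proof -
  have "((\<lambda>s. integral (cbox 0 (2 * pi)) (\<lambda>\<theta>. f s \<theta> * \<rho> \<theta>)) has_field_derivative
          integral (cbox 0 (2 * pi)) (\<lambda>\<theta>. g t \<theta> * \<rho> \<theta>)) (at t within {0<..})"
  proof (rule leibniz_rule_field_derivative)
    show "((\<lambda>s. f s \<theta> * \<rho> \<theta>) has_field_derivative g s \<theta> * \<rho> \<theta>) (at s within {0<..})"
      if "s \<in> {0<..}" for s \<theta>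
      using that by (auto intro!: DERIV_cmult_right has_field_derivative_at_within[OF der])
    show "(\<lambda>\<theta>. f s \<theta> * \<rho> \<theta>) integrable_on cbox 0 (2 * pi)" if "s \<in> {0<..}" for s
      using that cont_f integrable_weighted by auto
    show "continuous_on ({0<..} \<times> cbox 0 (2 * pi)) (\<lambda>(s, \<theta>). g s \<theta> * \<rho> \<theta>)"
      using cont_g by (auto simp: case_prod_beta intro!: continuous_intros)
  qed (use t in auto)
  then show ?thesis
    using t by (simp add: avg_def at_within_open[of t "{0<..}"])
qed

section \<open>The mean field, the mean velocity and their evolution\<close>

definition C where "C t = avg (\<lambda>\<theta>. cos (\<eta> \<theta> t))"
definition S where "S t = avg (\<lambda>\<theta>. sin (\<eta> \<theta> t))"
definition V where "V t = avg (\<lambda>\<theta>. v \<theta> t)"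
definition D where "D \<theta> t = S t * cos (\<eta> \<theta> t) - C t * sin (\<eta> \<theta> t)"
definition w where "w \<theta> t = v \<theta> t - V t"
definition E where "E t = avg (\<lambda>\<theta>. (w \<theta> t)\<^sup>2) / 2"

lemma cont_C: "continuous_on {0..} C"
  unfolding C_def by (rule cont_avg) (auto simp: case_prod_beta intro!: continuous_intros)

lemma cont_S: "continuous_on {0..} S"
  unfolding S_def by (rule cont_avg) (auto simp: case_prod_beta intro!: continuous_intros)

lemma cont_V: "continuous_on {0..} V"
  unfolding V_def by (rule cont_avg) (auto simp: case_prod_beta intro!: continuous_intros)

lemma cont_CSV_comp [continuous_intros]:
  assumes "continuous_on X b" "\<And>x. x \<in> X \<Longrightarrow> b x \<ge> 0"
  shows "continuous_on X (\<lambda>x. C (b x))" "continuous_on X (\<lambda>x. S (b x))"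
    "continuous_on X (\<lambda>x. V (b x))"
  using continuous_on_compose2[OF cont_C assms(1)] continuous_on_compose2[OF cont_S assms(1)]
    continuous_on_compose2[OF cont_V assms(1)] assms(2) by auto

lemma cont_E: "continuous_on {0..} E"
  unfolding E_def w_def
  by (intro continuous_intros cont_avg) (auto simp: case_prod_beta intro!: continuous_intros)

text \<open>The addition formula for the sine separates the two labels, so the other oscillators act
  only through \<open>C\<close> and \<open>S\<close>.\<close>

lemma coupling_eq_D:
  assumes "t \<ge> 0"
  shows "integral {0..2 * pi} (\<lambda>\<theta>'. sin (\<eta> \<theta>' t - \<eta> \<theta> t) * \<rho> \<theta>') = D \<theta> t"
proof -
  have "integral {0..2 * pi} (\<lambda>\<theta>'. sin (\<eta> \<theta>' t - \<eta> \<theta> t) * \<rho> \<theta>')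
      = avg (\<lambda>\<theta>'. cos (\<eta> \<theta> t) * sin (\<eta> \<theta>' t) - sin (\<eta> \<theta> t) * cos (\<eta> \<theta>' t))"
    unfolding avg_def by (simp add: sin_diff mult.commute)
  also have "\<dots> = D \<theta> t"
    using assms by (subst avg_diff) (auto simp: avg_cmult D_def C_def S_def intro!: continuous_intros)
  finally show ?thesis .
qed

lemma v_deriv':
  "t > 0 \<Longrightarrow> ((\<lambda>s. v \<theta> s) has_real_derivative K / m * D \<theta> t - 1 / m * v \<theta> t) (at t)"
  using v_deriv[of t \<theta>] by (simp add: coupling_eq_D)

lemma C_deriv:
  assumes "t > 0"
  shows "(C has_real_derivative - avg (\<lambda>\<theta>. v \<theta> t * sin (\<eta> \<theta> t))) (at t)"
proof -
  have "((\<lambda>s. avg (\<lambda>\<theta>. cos (\<eta> \<theta> s))) has_real_derivative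
      avg (\<lambda>\<theta>. (-1) * (v \<theta> t * sin (\<eta> \<theta> t)))) (at t)"
    using assms
    by (intro avg_has_derivative[where g = "\<lambda>t \<theta>. (-1) * (v \<theta> t * sin (\<eta> \<theta> t))"])
      (auto simp: case_prod_beta intro!: continuous_intros derivative_eq_intros eta_deriv)
  then show ?thesis
    unfolding C_def[abs_def] avg_cmult by simp
qed

lemma S_deriv:
  assumes "t > 0"
  shows "(S has_real_derivative avg (\<lambda>\<theta>. v \<theta> t * cos (\<eta> \<theta> t))) (at t)"
  unfolding S_def[abs_def] using assms
  by (intro avg_has_derivative[where g = "\<lambda>t \<theta>. v \<theta> t * cos (\<eta> \<theta> t)"])
    (auto simp: case_prod_beta intro!: continuous_intros derivative_eq_intros eta_deriv)

text \<open>The pairwise couplings are antisymmetric and cancel in the mean: the average of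
  \<open>D\<close> is \<open>S t * C t - C t * S t = 0\<close>. Only friction is left.\<close>

lemma V_deriv:
  assumes t: "t > 0"
  shows "(V has_real_derivative - (1 / m) * V t) (at t)"
proof -
  have "((\<lambda>s. avg (\<lambda>\<theta>. v \<theta> s)) has_real_derivative
      avg (\<lambda>\<theta>. K / m * D \<theta> t - 1 / m * v \<theta> t)) (at t)"
    using assms
    by (intro avg_has_derivative[where g = "\<lambda>t \<theta>. K / m * D \<theta> t - 1 / m * v \<theta> t"] v_deriv')
      (use m_pos in \<open>auto simp: case_prod_beta D_def intro!: continuous_intros\<close>)
  also have "avg (\<lambda>\<theta>. K / m * D \<theta> t - 1 / m * v \<theta> t)
      = K / m * avg (\<lambda>\<theta>. D \<theta> t) - 1 / m * V t"
    unfolding D_def V_def avg_cmult[symmetric] using t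
    by (intro avg_diff continuous_intros) auto
  also have "avg (\<lambda>\<theta>. D \<theta> t) = S t * C t - C t * S t"
    unfolding D_def using t
    by (subst avg_diff) (auto simp: avg_cmult C_def S_def intro!: continuous_intros)
  finally show ?thesis unfolding V_def[abs_def] by simp
qed

section \<open>Energy balance of the centred velocity\<close>

lemma w_deriv:
  assumes "t > 0"
  shows "((\<lambda>s. w \<theta> s) has_real_derivative K / m * D \<theta> t - 1 / m * w \<theta> t) (at t)"
  unfolding w_def using assms
  by (auto intro!: derivative_eq_intros v_deriv' V_deriv simp: algebra_simps)

text \<open>Up to the factor \<open>K\<close>, the power that the coupling force transfers to the
  centred motion.\<close>

definition work where "work t = avg (\<lambda>\<theta>. w \<theta> t * D \<theta> t)"

text \<open>As \<open>D\<close> has mean zero, subtracting \<open>V\<close> from the velocity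
  changes nothing. By \<open>C_deriv\<close> and \<open>S_deriv\<close> the right-hand side is half
  the derivative of \<open>C^2 + S^2\<close>.\<close>

lemma work_eq:
  assumes t: "t > 0"
  shows "work t = S t * avg (\<lambda>\<theta>. v \<theta> t * cos (\<eta> \<theta> t)) - C t * avg (\<lambda>\<theta>. v \<theta> t * sin (\<eta> \<theta> t))"
proof -
  have "work t = avg (\<lambda>\<theta>. S t * (v \<theta> t * cos (\<eta> \<theta> t)) - C t * (v \<theta> t * sin (\<eta> \<theta> t))
      - (V t * S t * cos (\<eta> \<theta> t) - V t * C t * sin (\<eta> \<theta> t)))"
    unfolding work_def w_def D_def by (simp add: algebra_simps)
  also have "\<dots> = avg (\<lambda>\<theta>. S t * (v \<theta> t * cos (\<eta> \<theta> t)) - C t * (v \<theta> t * sin (\<eta> \<theta> t)))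
      - avg (\<lambda>\<theta>. V t * S t * cos (\<eta> \<theta> t) - V t * C t * sin (\<eta> \<theta> t))"
    using t by (intro avg_diff continuous_intros) auto
  also have "avg (\<lambda>\<theta>. S t * (v \<theta> t * cos (\<eta> \<theta> t)) - C t * (v \<theta> t * sin (\<eta> \<theta> t)))
      = S t * avg (\<lambda>\<theta>. v \<theta> t * cos (\<eta> \<theta> t)) - C t * avg (\<lambda>\<theta>. v \<theta> t * sin (\<eta> \<theta> t))"
    unfolding avg_cmult[symmetric] using t by (intro avg_diff continuous_intros) auto
  also have "avg (\<lambda>\<theta>. V t * S t * cos (\<eta> \<theta> t) - V t * C t * sin (\<eta> \<theta> t))
      = V t * S t * avg (\<lambda>\<theta>. cos (\<eta> \<theta> t)) - V t * C t * avg (\<lambda>\<theta>. sin (\<eta> \<theta> t))"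
    unfolding avg_cmult[symmetric] using t by (intro avg_diff continuous_intros) auto
  finally show ?thesis by (simp add: C_def S_def)
qed

text \<open>The equation for \<open>w\<close> is multiplied by \<open>w\<close> and averaged;
  friction gives \<open>2 / m * E t\<close> because \<open>E\<close> carries the factor 1/2.\<close>

lemma E_deriv:
  assumes t: "t > 0"
  shows "(E has_real_derivative K / m * work t - 2 / m * E t) (at t)"
proof -
  have "((\<lambda>s. avg (\<lambda>\<theta>. (w \<theta> s)\<^sup>2)) has_real_derivative
      avg (\<lambda>\<theta>. 2 * K / m * (w \<theta> t * D \<theta> t) - 2 / m * (w \<theta> t)\<^sup>2)) (at t)"
  proof (rule avg_has_derivative[where g = "\<lambda>t \<theta>. 2 * K / m * (w \<theta> t * D \<theta> t) - 2 / m * (w \<theta> t)\<^sup>2"])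
    show "((\<lambda>s. (w \<theta> s)\<^sup>2) has_real_derivative
        2 * K / m * (w \<theta> s * D \<theta> s) - 2 / m * (w \<theta> s)\<^sup>2) (at s)" if "s > 0" for s \<theta>
      using that
      by (auto intro!: derivative_eq_intros w_deriv simp: algebra_simps power2_eq_square)
  qed (use t m_pos in \<open>auto simp: case_prod_beta D_def w_def intro!: continuous_intros\<close>)
  also have "avg (\<lambda>\<theta>. 2 * K / m * (w \<theta> t * D \<theta> t) - 2 / m * (w \<theta> t)\<^sup>2)
      = 2 * K / m * work t - 2 / m * avg (\<lambda>\<theta>. (w \<theta> t)\<^sup>2)"
    unfolding work_def avg_cmult[symmetric] w_def D_def
    using t by (intro avg_diff continuous_intros) auto
  finally show ?thesis
    unfolding E_def[abs_def] by (auto intro!: derivative_eq_intros simp: field_simps)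
qed

text \<open>The weights are chosen to cancel \<open>work\<close>: both terms contribute
  \<open>K / 2 * work t\<close> to the derivative, with opposite signs, and the friction term that
  remains is exactly \<open>E t\<close>.\<close>

definition lyapunov where "lyapunov t = K / 4 * ((C t)\<^sup>2 + (S t)\<^sup>2) - m / 2 * E t"

lemma lyapunov_deriv:
  assumes "t > 0"
  shows "(lyapunov has_real_derivative E t) (at t)"
  unfolding lyapunov_def[abs_def] using assms m_pos
  by (auto intro!: derivative_eq_intros C_deriv S_deriv E_deriv simp: work_eq field_simps)

lemma cont_lyapunov: "continuous_on {0..} lyapunov"
  unfolding lyapunov_def by (intro continuous_intros cont_C cont_S cont_E)

section \<open>A priori bounds\<close>

lemma E_nonneg: "t \<ge> 0 \<Longrightarrow> E t \<ge> 0"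
  using avg_mono[of "\<lambda>_. 0" "\<lambda>\<theta>. (w \<theta> t)\<^sup>2"]
  by (simp add: E_def w_def avg_const continuous_intros)

text \<open>By Jensen: \<open>C\<^sup>2 + S\<^sup>2\<close> is the mean of \<open>C cos \<eta> + S sin \<eta> \<le> (C\<^sup>2 + S\<^sup>2 + 1) / 2\<close>.\<close>

lemma order_parameter_le_1:
  assumes t: "t \<ge> 0"
  shows "(C t)\<^sup>2 + (S t)\<^sup>2 \<le> 1"
proof -
  let ?c = "\<lambda>\<theta>. cos (\<eta> \<theta> t)" and ?s = "\<lambda>\<theta>. sin (\<eta> \<theta> t)"
  have "avg (\<lambda>\<theta>. C t * ?c \<theta> + S t * ?s \<theta>) \<le> avg (\<lambda>\<theta>. ((C t)\<^sup>2 + (S t)\<^sup>2 + 1) / 2)"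
  proof (rule avg_mono)
    fix \<theta>
    have "0 \<le> (C t - ?c \<theta>)\<^sup>2 + (S t - ?s \<theta>)\<^sup>2" by simp
    also have "\<dots> = (C t)\<^sup>2 + (S t)\<^sup>2 + ((?s \<theta>)\<^sup>2 + (?c \<theta>)\<^sup>2) - 2 * (C t * ?c \<theta> + S t * ?s \<theta>)"
      by (simp add: power2_diff algebra_simps)
    finally show "C t * ?c \<theta> + S t * ?s \<theta> \<le> ((C t)\<^sup>2 + (S t)\<^sup>2 + 1) / 2"
      unfolding sin_cos_squared_add by simp
  qed (use t in \<open>auto intro!: continuous_intros\<close>)
  moreover have "avg (\<lambda>\<theta>. C t * ?c \<theta> + S t * ?s \<theta>) = (C t)\<^sup>2 + (S t)\<^sup>2"
    using t
    by (subst avg_add) (auto simp: avg_cmult C_def S_def power2_eq_square intro!: continuous_intros)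
  ultimately show ?thesis by (simp add: avg_const)
qed

text \<open>Since \<open>C\<close> and \<open>S\<close> are at most 1 in absolute value, the force
  is at most 2, and Young's inequality trades the factor \<open>w\<close> for kinetic energy. The
  bound serves to control the derivative of \<open>E\<close>.\<close>

lemma abs_work_le:
  assumes t: "t > 0"
  shows "\<bar>work t\<bar> \<le> E t + 2"
proof -
  have "(C t)\<^sup>2 \<le> 1" "(S t)\<^sup>2 \<le> 1"
    using order_parameter_le_1[of t] t zero_le_power2[of "C t"] zero_le_power2[of "S t"]
    by linarith+
  then have CS: "\<bar>C t\<bar> \<le> 1" "\<bar>S t\<bar> \<le> 1"
    by (simp_all only: abs_square_le_1)
  have D2: "\<bar>D \<theta> t\<bar> \<le> 2" for \<theta>
  proof -
    have "\<bar>S t * cos (\<eta> \<theta> t)\<bar> \<le> 1" "\<bar>C t * sin (\<eta> \<theta> t)\<bar> \<le> 1"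
      unfolding abs_mult using CS by (auto intro!: mult_le_one)
    then show ?thesis unfolding D_def by linarith
  qed
  have bd: "\<bar>w \<theta> t * D \<theta> t\<bar> \<le> 1 / 2 * (w \<theta> t)\<^sup>2 + 2" for \<theta>
  proof -
    have "\<bar>w \<theta> t * D \<theta> t\<bar> \<le> \<bar>w \<theta> t\<bar> * 2"
      unfolding abs_mult using D2 by (intro mult_left_mono) auto
    \<comment> \<open>Expanding this square gives Young's inequality
      \<open>2 * |w| <= w^2 / 2 + 2\<close>.\<close>
    moreover have "0 \<le> (\<bar>w \<theta> t\<bar> - 2)\<^sup>2" by simp
    ultimately show ?thesis by (simp add: power2_diff)
  qed
  have *: "avg (\<lambda>\<theta>. 1 / 2 * (w \<theta> t)\<^sup>2 + 2) = E t + 2"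
    unfolding w_def E_def using t
    \<comment> \<open>Without the deleted rule, \<open>1 / 2\<close> stays a left factor and
      \<open>avg_cmult\<close> matches.\<close>
    by (subst avg_add) (auto simp: avg_cmult avg_const simp del: times_divide_eq_left
        intro!: continuous_intros)
  have "avg (\<lambda>\<theta>. w \<theta> t * D \<theta> t) \<le> avg (\<lambda>\<theta>. 1 / 2 * (w \<theta> t)\<^sup>2 + 2)"
    using t bd by (intro avg_mono) (auto simp: abs_le_iff w_def D_def intro!: continuous_intros)
  \<comment> \<open>The same estimate for the negative yields the lower bound on
    \<open>work t\<close>.\<close>
  moreover have "avg (\<lambda>\<theta>. (-1) * (w \<theta> t * D \<theta> t)) \<le> avg (\<lambda>\<theta>. 1 / 2 * (w \<theta> t)\<^sup>2 + 2)"
    using t bd by (intro avg_mono) (auto simp: abs_le_iff w_def D_def intro!: continuous_intros)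
  ultimately show ?thesis
    unfolding * avg_cmult work_def by linarith
qed

section \<open>Monotonicity of the Lyapunov function and the limits at infinity\<close>

lemma lyapunov_mono:
  assumes "0 \<le> s" "s \<le> t"
  shows "lyapunov s \<le> lyapunov t"
\<comment> \<open>The derivative is available only at positive times, while \<open>s\<close> may be
  0; continuity covers the end point.\<close>
proof (rule DERIV_nonneg_imp_increasing_open[OF \<open>s \<le> t\<close>])
  show "continuous_on {s..t} lyapunov"
    using assms by (intro continuous_on_subset[OF cont_lyapunov]) auto
qed (use assms in \<open>auto intro!: exI lyapunov_deriv E_nonneg\<close>)

lemma lyapunov_le: "t \<ge> 0 \<Longrightarrow> lyapunov t \<le> K / 4 - m / 2 * E t"
  using order_parameter_le_1[of t] K_pos unfolding lyapunov_def by simp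

lemma lyapunov_bounded:
  assumes "t \<ge> 0"
  shows "lyapunov t \<le> K / 4"
proof -
  have "0 \<le> m / 2 * E t" using m_pos E_nonneg[OF assms] by simp
  then show ?thesis using lyapunov_le[OF assms] by linarith
qed

text \<open>This is the chain \<open>lyapunov 0 <= lyapunov t <= K / 4 - m / 2 * E t\<close>, solved
  for \<open>E t\<close>.\<close>

lemma E_bounded:
  assumes "t \<ge> 0"
  shows "E t \<le> 2 / m * (K / 4 - lyapunov 0)"
  using lyapunov_le[OF assms] lyapunov_mono[of 0 t] assms m_pos by (simp add: field_simps)

text \<open>Being monotone and bounded, \<open>lyapunov\<close> converges. Its derivative
  \<open>E\<close> has a bounded derivative, so Barbalat's lemma applies, and the integral of
  \<open>E\<close> is the total increase of \<open>lyapunov\<close>.\<close>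

lemma E_tendsto_0_and_lyapunov_tendsto:
  shows "(E \<longlongrightarrow> 0) at_top"
    and "E integrable_on {0..}"
    and "(lyapunov \<longlongrightarrow> lyapunov 0 + integral {0..} E) at_top"
proof -
  obtain l where l: "(lyapunov \<longlongrightarrow> l) at_top"
    using tendsto_at_top_mono_bounded[of 0 lyapunov, OF lyapunov_mono lyapunov_bounded] by blast
  define B where "B = 2 / m * (K / 4 - lyapunov 0)"
  show "(E \<longlongrightarrow> 0) at_top"
  proof (rule barbalat[OF lyapunov_deriv E_deriv _ l])
    fix t :: real assume t: "0 < t"
    have "\<bar>K / m * work t\<bar> \<le> K / m * (B + 2)"
      unfolding abs_mult using abs_work_le[OF t] E_bounded[of t] t m_pos K_pos
      by (intro mult_mono) (auto simp: B_def)
    moreover have "\<bar>2 / m * E t\<bar> \<le> 2 / m * B"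
      unfolding abs_mult using E_bounded[of t] E_nonneg[of t] t m_pos
      by (intro mult_mono) (auto simp: B_def)
    ultimately show "\<bar>K / m * work t - 2 / m * E t\<bar> \<le> K / m * (B + 2) + 2 / m * B"
      by linarith
  qed
  have int: "(E has_integral lyapunov y - lyapunov 0) {0..y}" if "y \<ge> 0" for y
    using that
    by (intro fundamental_theorem_of_calculus_interior continuous_on_subset[OF cont_lyapunov])
      (auto intro: lyapunov_deriv simp: has_real_derivative_iff_has_vector_derivative[symmetric])
  have "(E has_integral l - lyapunov 0) {0..}"
  proof (rule has_integral_to_inf)
    \<comment> \<open>For negative \<open>y\<close> the interval is empty.\<close>
    show "E integrable_on {0..y}" for y
      using int[of y] by (cases "y \<ge> 0") auto
    have "((\<lambda>y. lyapunov y - lyapunov 0) \<longlongrightarrow> l - lyapunov 0) at_top"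
      by (intro tendsto_intros l)
    moreover have "eventually (\<lambda>y. lyapunov y - lyapunov 0 = integral {0..y} E) at_top"
      using eventually_ge_at_top[of 0] by eventually_elim (simp add: integral_unique[OF int])
    ultimately show "((\<lambda>y. integral {0..y} E) \<longlongrightarrow> l - lyapunov 0) at_top"
      by (rule Lim_transform_eventually)
  qed (rule E_nonneg)
  then show "E integrable_on {0..}" and "(lyapunov \<longlongrightarrow> lyapunov 0 + integral {0..} E) at_top"
    using l by (auto simp: integral_unique)
qed

text \<open>The definition of \<open>lyapunov\<close> is solved for \<open>C^2 + S^2\<close>. The
  energy term disappears at infinity but survives at time 0.\<close>

lemma order_parameter_tendsto:
  "((\<lambda>t. (C t)\<^sup>2 + (S t)\<^sup>2) \<longlongrightarrow>
      (C 0)\<^sup>2 + (S 0)\<^sup>2 - 2 * m / K * E 0 + 4 / K * integral {0..} E) at_top"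
proof -
  have eq: "(\<lambda>t. (C t)\<^sup>2 + (S t)\<^sup>2) = (\<lambda>t. 4 / K * (lyapunov t + m / 2 * E t))"
    using K_pos by (auto simp: lyapunov_def)
  have "(\<dots> \<longlongrightarrow> 4 / K * (lyapunov 0 + integral {0..} E + m / 2 * 0)) at_top"
    by (intro tendsto_intros E_tendsto_0_and_lyapunov_tendsto)
  also have "4 / K * (lyapunov 0 + integral {0..} E + m / 2 * 0)
      = (C 0)\<^sup>2 + (S 0)\<^sup>2 - 2 * m / K * E 0 + 4 / K * integral {0..} E"
    using K_pos by (simp add: lyapunov_def field_simps)
  finally show ?thesis unfolding eq .
qed

section \<open>Return to the kinetic energy and the order parameter of the statement\<close>

lemma kinetic_energy_eq: "kinetic_energy \<rho> v = E"
  by (auto simp: kinetic_energy_def mean_velocity_def E_def avg_def w_def V_def)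

text \<open>Taking the modulus removes the phase factor, so \<open>r t\<close> does not depend on
  the choice of \<open>\<phi>\<close>.\<close>

lemma order_parameter_phase_eq:
  assumes "order_parameter_phase \<rho> \<eta> r \<phi>" and t: "t \<ge> 0"
  shows "r t = sqrt ((C t)\<^sup>2 + (S t)\<^sup>2)"
proof -
  let ?f = "\<lambda>\<theta>. exp (\<i> * complex_of_real (\<eta> \<theta> t)) * complex_of_real (\<rho> \<theta>)"
  have r: "r t \<ge> 0" "complex_of_real (r t) * exp (\<i> * complex_of_real (\<phi> t)) = integral {0..2 * pi} ?f"
    using assms unfolding order_parameter_phase_def by auto
  have int: "?f integrable_on {0..2 * pi}"
    using t by (intro integrable_continuous_real continuous_intros cont_rho) auto
  have Re_Im: "Re \<circ> ?f = (\<lambda>\<theta>. cos (\<eta> \<theta> t) * \<rho> \<theta>)" "Im \<circ> ?f = (\<lambda>\<theta>. sin (\<eta> \<theta> t) * \<rho> \<theta>)"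
    by (auto simp: Re_exp Im_exp)
  have "Re (integral {0..2 * pi} ?f) = C t"
    unfolding C_def avg_def Re_Im[symmetric]
    by (rule integral_linear[OF int bounded_linear_Re, symmetric])
  moreover have "Im (integral {0..2 * pi} ?f) = S t"
    unfolding S_def avg_def Re_Im[symmetric]
    by (rule integral_linear[OF int bounded_linear_Im, symmetric])
  moreover have "norm (integral {0..2 * pi} ?f) = r t"
    using r(1) unfolding r(2)[symmetric] norm_mult by simp
  ultimately show ?thesis by (simp add: cmod_def)
qed

end

text \<open>The integrability conjunct certifies that the integral over \<open>{0..}\<close> is a
  genuine value and not the default 0. The radicand is nonnegative as a limit of
  \<open>C^2 + S^2\<close>.\<close>

theorem theorem4p1:
  fixes m K :: real
    and \<rho>0 u0 :: "real \<Rightarrow> real"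
    and \<eta> h v :: "real \<Rightarrow> real \<Rightarrow> real"
    and r \<phi> :: "real \<Rightarrow> real"
  assumes "m > 0" and "K > 0"
    and "\<And>\<theta>. \<rho>0 (\<theta> + 2 * pi) = \<rho>0 \<theta>" and "\<And>\<theta>. \<rho>0 \<theta> \<ge> 0"
    and "(\<rho>0 has_integral 1) {0..2 * pi}"
    and "global_classical_solution m K \<rho>0 u0 \<eta> h v"
    and "order_parameter_phase \<rho>0 \<eta> r \<phi>"
  shows "(kinetic_energy \<rho>0 v \<longlongrightarrow> 0) at_top \<and>
         kinetic_energy \<rho>0 v integrable_on {0..} \<and>
         (r \<longlongrightarrow> sqrt ((r 0)\<^sup>2 - 2 * m / K * kinetic_energy \<rho>0 v 0
                        + 4 / K * integral {0..} (kinetic_energy \<rho>0 v))) at_top"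
proof -
  note sol = assms(6)[unfolded global_classical_solution_def]
  have init: "\<forall>\<theta>. \<eta> \<theta> 0 = \<theta> \<and> h \<theta> 0 = \<rho>0 \<theta> \<and> v \<theta> 0 = u0 \<theta>"
    using sol by (elim conjE)
  have cont_h: "continuous_on (UNIV \<times> {0..}) (\<lambda>(\<theta>, t). h \<theta> t)"
    using sol by (elim conjE)
  have diff: "\<forall>\<theta>. \<forall>t>0. (\<lambda>s. v \<theta> s) differentiable at t"
    using sol by (elim conjE)
  have eta': "\<forall>\<theta>. \<forall>t>0. ((\<lambda>s. \<eta> \<theta> s) has_real_derivative v \<theta> t) (at t)"
    using sol by (elim conjE)
  have v': "\<forall>\<theta>. \<forall>t>0. deriv (\<lambda>s. v \<theta> s) t + 1 / m * v \<theta> t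
        = K / m * integral {0..2 * pi} (\<lambda>\<theta>'. sin (\<eta> \<theta>' t - \<eta> \<theta> t) * \<rho>0 \<theta>')"
    using sol by (elim conjE)
  interpret inertial_kuramoto m K \<rho>0 \<eta> v
  proof
    show "continuous_on {0..2 * pi} \<rho>0"
      \<comment> \<open>On the slice \<open>t = 0\<close> the function \<open>h\<close> equals
        \<open>\<rho>0\<close>, which therefore inherits its continuity.\<close>
      using continuous_on_compose2[OF cont_h, of "{0..2 * pi}" "\<lambda>\<theta>. (\<theta>, 0)"] init
      by (simp add: continuous_on_Pair image_subset_iff)
    show "continuous_on (UNIV \<times> {0..}) (\<lambda>(\<theta>, t). \<eta> \<theta> t)"
      using sol by (elim conjE)
    show "continuous_on (UNIV \<times> {0..}) (\<lambda>(\<theta>, t). v \<theta> t)"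
      using sol by (elim conjE)
  next
    fix \<theta> t :: real assume t: "t > 0"
    show "((\<lambda>s. \<eta> \<theta> s) has_real_derivative v \<theta> t) (at t)"
      using eta' t by simp
    have "((\<lambda>s. v \<theta> s) has_real_derivative deriv (\<lambda>s. v \<theta> s) t) (at t)"
      using diff t by (simp add: DERIV_deriv_iff_real_differentiable)
    moreover have "deriv (\<lambda>s. v \<theta> s) t = K / m * integral {0..2 * pi}
        (\<lambda>\<theta>'. sin (\<eta> \<theta>' t - \<eta> \<theta> t) * \<rho>0 \<theta>') - 1 / m * v \<theta> t"
      unfolding eq_diff_eq using v' t by simp
    ultimately show "((\<lambda>s. v \<theta> s) has_real_derivative
        K / m * integral {0..2 * pi} (\<lambda>\<theta>'. sin (\<eta> \<theta>' t - \<eta> \<theta> t) * \<rho>0 \<theta>') - 1 / m * v \<theta> t) (at t)"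
      by (simp only:)
  qed (rule assms)+
  note r = order_parameter_phase_eq[OF assms(7)]
  have "((\<lambda>t. sqrt ((C t)\<^sup>2 + (S t)\<^sup>2)) \<longlongrightarrow>
      sqrt ((r 0)\<^sup>2 - 2 * m / K * E 0 + 4 / K * integral {0..} E)) at_top"
    using tendsto_real_sqrt[OF order_parameter_tendsto] by (simp add: r)
  \<comment> \<open>The predicate \<open>order_parameter_phase\<close> determines \<open>r\<close>
    only at nonnegative times.\<close>
  moreover have "eventually (\<lambda>t. sqrt ((C t)\<^sup>2 + (S t)\<^sup>2) = r t) at_top"
    using eventually_ge_at_top[of 0] by eventually_elim (simp add: r)
  ultimately have "(r \<longlongrightarrow> sqrt ((r 0)\<^sup>2 - 2 * m / K * E 0 + 4 / K * integral {0..} E)) at_top"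
    by (rule Lim_transform_eventually)
  then show ?thesis
    using E_tendsto_0_and_lyapunov_tendsto unfolding kinetic_energy_eq by blast
qed

end
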